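(* Let $H_0,\dots,H_m\in\mathbb{R}^{n\times n}$ be symmetric matrices and let $G(\delta)=H_0+\sum_{i=1}^m\delta_iH_i$ for $\delta\in\mathbb{R}^m$. Let $\Delta$ be the simplex $\Delta=\{\delta\in\mathbb{R}^m\mid \delta\ge 0,\ \mathbf{1}^T\delta\le 1\}$. Then $G(\delta)\ge 0$ for all $\delta\in\Delta$ if and only if there exist positive semidefinite (constant, symmetric) matrices $S_0,\dots,S_{m+1}\in\mathbb{R}^{n\times n}$ such that, identically in $\delta$, $$G(\delta)=S_0+\sum_{i=1}^m\delta_iS_i+(1-\mathbf{1}^T\delta)S_{m+1}.$$
   Context: For a vector, $\delta\ge 0$ is meant entrywise; for a symmetric matrix $X$, $X\ge 0$ means positive semidefinite. $\mathbf{1}$ is the all-ones vector. *)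

theory Defs
  imports "HOL-Analysis.Analysis"
begin

definition symmetric_matrix :: "real ^ 'n ^ 'n \<Rightarrow> bool" where
  "symmetric_matrix X \<longleftrightarrow> transpose X = X"

definition psd :: "real ^ 'n ^ 'n \<Rightarrow> bool" where
  "psd X \<longleftrightarrow> symmetric_matrix X \<and> (\<forall>v. v \<bullet> (X *v v) \<ge> 0)"

definition affine_pencil ::
  "real ^ 'n ^ 'n \<Rightarrow> ('m::finite \<Rightarrow> real ^ 'n ^ 'n) \<Rightarrow> real ^ 'm \<Rightarrow> real ^ 'n ^ 'n" where
  "affine_pencil H0 H \<delta> = H0 + (\<Sum>i\<in>UNIV. (\<delta> $ i) *\<^sub>R H i)"

(* The order on real ^ 'm is componentwise and 1 :: real ^ 'm is the all-ones vector.
   The sum is bounded by 1, not equal to 1: this is the full-dimensional simplex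
   with vertices 0 and the unit vectors. *)
definition corner_simplex :: "(real ^ 'm) set" where
  "corner_simplex = {\<delta>. \<delta> \<ge> 0 \<and> 1 \<bullet> \<delta> \<le> 1}"

end

theory Submission
  imports Defs
begin

text \<open>A pencil that is affine in the parameter is determined by its values at the vertices of the
  simplex: writing a point in barycentric coordinates gives
  \<open>G(\<delta>) = (1 - 1 \<bullet> \<delta>) G(0) + (\<Sum>i. \<delta>\<^sub>i G(e\<^sub>i))\<close>, so one may take \<open>S0 = 0\<close>.\<close>

lemma one_inner_vec: "1 \<bullet> (x :: real ^ 'm) = (\<Sum>i\<in>UNIV. x $ i)"
  by (simp add: inner_vec_def)

lemma psd_zero: "psd 0"
  by (simp add: psd_def symmetric_matrix_def transpose_def vec_eq_iff)

lemma psd_add: "psd X \<Longrightarrow> psd Y \<Longrightarrow> psd (X + Y)"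
  by (simp add: psd_def symmetric_matrix_def transpose_def vec_eq_iff
      matrix_vector_mult_add_rdistrib inner_add_right)

lemma psd_scaleR: "c \<ge> 0 \<Longrightarrow> psd X \<Longrightarrow> psd (c *\<^sub>R X)"
  by (simp add: psd_def symmetric_matrix_def transpose_def vec_eq_iff
      scaleR_matrix_vector_assoc[symmetric])

text \<open>Over an infinite \<open>I\<close> the sum is 0 by convention, so \<open>psd_zero\<close>
  covers that case as well as the empty one.\<close>

lemma psd_sum: "(\<And>i. i \<in> I \<Longrightarrow> psd (X i)) \<Longrightarrow> psd (\<Sum>i\<in>I. X i)"
  by (induction I rule: infinite_finite_induct) (auto intro: psd_zero psd_add)

lemma zero_in_corner_simplex: "0 \<in> corner_simplex"
  by (simp add: corner_simplex_def)

lemma axis_in_corner_simplex: "axis i 1 \<in> corner_simplex"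
  by (simp add: corner_simplex_def less_eq_vec_def axis_def one_inner_vec)

lemma affine_pencil_zero: "affine_pencil H0 H 0 = H0"
  by (simp add: affine_pencil_def)

lemma affine_pencil_axis: "affine_pencil H0 H (axis i 1) = H0 + H i"
  by (simp add: affine_pencil_def axis_def if_distrib[of "\<lambda>c. c *\<^sub>R _"] cong: if_cong)

text \<open>The weights on the right add up to 1, so the multiples of \<open>H0\<close> recombine to
  a single \<open>H0\<close>. No sign of a weight enters, hence the identity holds for every
  \<delta>, also outside the simplex.\<close>

lemma affine_pencil_barycentric:
  "affine_pencil H0 H \<delta> = (\<Sum>i\<in>UNIV. (\<delta> $ i) *\<^sub>R (H0 + H i)) + (1 - 1 \<bullet> \<delta>) *\<^sub>R H0"
  by (simp add: affine_pencil_def one_inner_vec scaleR_right_distrib sum.distrib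
      scaleR_sum_left scaleR_left_diff_distrib)

theorem theorem7:
  fixes H0 :: "real ^ 'n ^ 'n" and H :: "'m::finite \<Rightarrow> real ^ 'n ^ 'n"
  assumes "symmetric_matrix H0" and "\<And>i. symmetric_matrix (H i)"
  shows "(\<forall>\<delta>\<in>corner_simplex. psd (affine_pencil H0 H \<delta>)) \<longleftrightarrow>
    (\<exists>(S0 :: real ^ 'n ^ 'n) (S :: 'm \<Rightarrow> real ^ 'n ^ 'n) (S1 :: real ^ 'n ^ 'n).
       psd S0 \<and> (\<forall>i. psd (S i)) \<and> psd S1 \<and>
       (\<forall>\<delta> :: real ^ 'm. affine_pencil H0 H \<delta> =
          S0 + (\<Sum>i\<in>UNIV. (\<delta> $ i) *\<^sub>R S i) + (1 - 1 \<bullet> \<delta>) *\<^sub>R S1))"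
    (is "?L \<longleftrightarrow> ?R")
proof
  assume L: ?L
  have "psd H0"
    using L zero_in_corner_simplex affine_pencil_zero by metis
  moreover have "psd (H0 + H i)" for i
    using L axis_in_corner_simplex affine_pencil_axis by metis
  \<comment> \<open>Each multiplier is the pencil at the vertex where its weight equals 1:
    \<open>H0 + H i\<close> at \<open>axis i 1\<close>, and \<open>H0\<close> at the origin.\<close>
  ultimately show ?R
    using psd_zero affine_pencil_barycentric[of H0 H]
    by (intro exI[of _ 0] exI[of _ "\<lambda>i. H0 + H i"] exI[of _ H0]) simp
next
  assume ?R
  then obtain S0 S1 :: "real ^ 'n ^ 'n" and S :: "'m \<Rightarrow> real ^ 'n ^ 'n"
    where S: "psd S0" "\<And>i. psd (S i)" "psd S1"
      and eq: "\<And>\<delta>. affine_pencil H0 H \<delta> =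
        S0 + (\<Sum>i\<in>UNIV. (\<delta> $ i) *\<^sub>R S i) + (1 - 1 \<bullet> \<delta>) *\<^sub>R S1"
    by blast
  show ?L
  proof
    fix \<delta> :: "real ^ 'm"
    assume "\<delta> \<in> corner_simplex"
    \<comment> \<open>The inequalities defining the simplex are exactly nonnegativity of the weights
      of \<open>S i\<close> and \<open>S1\<close>, so the right side of \<open>eq\<close> stays in
      the convex cone of psd matrices.\<close>
    then have "\<And>i. \<delta> $ i \<ge> 0" and "1 - 1 \<bullet> \<delta> \<ge> 0"
      by (simp_all add: corner_simplex_def less_eq_vec_def)
    then show "psd (affine_pencil H0 H \<delta>)"
      unfolding eq by (intro psd_add psd_sum psd_scaleR S)
  qed
qed

end
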